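(* Let $m,n\geq 2$. The set of matrices $B_{m,n}=\{\boldsymbol{u}\boldsymbol{u}' :\ \boldsymbol{u}\in U(m),\ \boldsymbol{u}'\in U(n)\}$ is an orthogonal basis of the vector space $\mathrm{V}_{m,n}$.
   Context: $\mathrm{V}_{m,n}$ is the subspace of real $m\times n$ matrices $(x_{ij})$ all of whose row sums and column sums are zero: $\sum_{k=1}^n x_{ik}=0$ for all $i$ and $\sum_{k=1}^m x_{kj}=0$ for all $j$. Matrices are regarded as vectors in $\mathbb{R}^{mn}$ with the entrywise (Frobenius) dot product. For $\boldsymbol{a}=(a_0,\dots,a_{m-1})$ and $\boldsymbol{b}=(b_0,\dots,b_{n-1})$, the outer product $\boldsymbol{a}\boldsymbol{b}$ is the $m\times n$ matrix whose $(i,j)$ entry is $a_ib_j$. Definition of $\boldsymbol{w}(k)$ for integers $k\geq 2$: $\boldsymbol{w}(k)=(w(k)_0,\dots,w(k)_{k-1})$, where: if $k$ is odd, $w(k)_i=(k-1)/2$ for $i$ even and $w(k)_i=-(k+1)/2$ for $i$ odd; $\boldsymbol{w}(2)=(1,-1)$; $\boldsymbol{w}(4)=(1,-1,-1,1)$; if $k=2m'$ is even with $k>4$, $w(k)_i=w(m')_{i \bmod m'}$ for $0\le i\le k-1$. (E.g. $\boldsymbol{w}(3)=(1,-2,1)$, $\boldsymbol{w}(5)=(2,-3,2,-3,2)$, $\boldsymbol{w}(6)=(1,-2,1,1,-2,1)$.) Definition of $U(n)$ for $n\ge 2$: build a rooted, vector-labeled binary tree $T_n$. The root is labeled $\boldsymbol{w}(n)\in\mathbb{R}^n$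 (coordinates indexed $0,\dots,n-1$). For a vertex with label $\boldsymbol{u}=(u_0,\dots,u_{n-1})$, let $i_0<\dots<i_{a'-1}$ be the indices $i$ with $u_i>0$ and $j_0<\dots<j_{a''-1}$ those with $u_j<0$. If $a'\ge2$, the vertex gets a left child labeled $\boldsymbol{u}'$ with $u'_{i_r}=w(a')_r$ ($0\le r\le a'-1$) and $u'_i=0$ for all other $i$. If $a''\ge 2$, it gets a right child labeled $\boldsymbol{u}''$ with $u''_{j_r}=w(a'')_r$ ($0\le r\le a''-1$) and $u''_i=0$ otherwise. If $a'=a''=1$ the vertex is a leaf. Then $U(n)=\{\boldsymbol{u}^1,\dots,\boldsymbol{u}^{n-1}\}$, where $\boldsymbol{u}^i$ is the label of the $i$-th vertex visited in a depth-first (preorder) traversal of $T_n$ that visits the left child before the right child. *)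

theory Defs
  imports "Jordan_Normal_Form.VS_Connect" "HOL-Library.Tree"
begin

(* Intended for k >= 2; the values at 0 and 1 are never used. *)
function vec_w :: "nat \<Rightarrow> real vec" where
  "vec_w k =
    (if odd k then vec k (\<lambda>i. if even i then (real k - 1) / 2 else - (real k + 1) / 2)
     else if k = 2 then vec_of_list [1, -1]
     else if k = 4 then vec_of_list [1, -1, -1, 1]
     else if k > 4 then vec k (\<lambda>i. vec_w (k div 2) $ (i mod (k div 2)))
     else 0\<^sub>v k)"
  by pat_completeness auto
termination by (relation "measure id") auto

declare vec_w.simps [simp del]

definition pos_idx :: "real vec \<Rightarrow> nat set" where
  "pos_idx u = {i. i < dim_vec u \<and> u $ i > 0}"

definition neg_idx :: "real vec \<Rightarrow> nat set" where
  "neg_idx u = {i. i < dim_vec u \<and> u $ i < 0}"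

(* For S a subset of {0..<n}: copies vec_w (card S) onto the coordinates in S in increasing order: the r-th smallest element
   of S, counting from 0, is the one with exactly r smaller elements in S. *)
definition place_w :: "nat \<Rightarrow> nat set \<Rightarrow> real vec" where
  "place_w n S = vec n (\<lambda>i. if i \<in> S then vec_w (card S) $ card {j \<in> S. j < i} else 0)"

lemma place_w_nth:
  assumes "S \<subseteq> {..<n}" and "r < card S"
  shows "place_w n S $ (sorted_list_of_set S ! r) = vec_w (card S) $ r"
proof -
  let ?xs = "sorted_list_of_set S"
  have fin: "finite S" using assms(1) finite_subset by blast
  have len: "length ?xs = card S" and st: "set ?xs = S" using fin by auto
  have in_S: "?xs ! r \<in> S" using assms(2) len st nth_mem by metis
  have mono: "?xs ! i < ?xs ! j \<longleftrightarrow> i < j" if "i < card S" "j < card S" for i j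
    using that len strict_sorted_list_of_set[of S]
    by (metis linorder_neqE_nat order_less_asym sorted_wrt_nth_less order_less_irrefl)
  have "{j \<in> S. j < ?xs ! r} = (\<lambda>i. ?xs ! i) ` {..<r}"
  proof (intro equalityI subsetI)
    fix j assume "j \<in> {j \<in> S. j < ?xs ! r}"
    then obtain i where "i < card S" "j = ?xs ! i" "j < ?xs ! r"
      using st len by (metis (no_types, lifting) in_set_conv_nth mem_Collect_eq)
    then show "j \<in> (\<lambda>i. ?xs ! i) ` {..<r}" using mono assms(2) by auto
  next
    fix j assume "j \<in> (\<lambda>i. ?xs ! i) ` {..<r}"
    then obtain i where "i < r" "j = ?xs ! i" by auto
    then show "j \<in> {j \<in> S. j < ?xs ! r}"
      using mono assms(2) len st by (metis (no_types, lifting) mem_Collect_eq nth_mem order_less_trans)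
  qed
  moreover have "inj_on (\<lambda>i. ?xs ! i) {..<r}"
    using mono assms(2) by (intro inj_onI) (metis lessThan_iff linorder_neqE_nat order_less_irrefl order_less_trans)
  ultimately have "card {j \<in> S. j < ?xs ! r} = r" by (simp add: card_image)
  then show ?thesis using in_S assms(1) by (auto simp: place_w_def)
qed

lemma dim_vec_w [simp]: "dim_vec (vec_w k) = k"
  by (subst vec_w.simps) auto

lemma finite_idx [simp]: "finite (pos_idx u)" "finite (neg_idx u)"
  by (auto simp: pos_idx_def neg_idx_def)

lemma idx_disjoint: "pos_idx u \<inter> neg_idx u = {}"
  by (auto simp: pos_idx_def neg_idx_def)

lemma vec_w_nonzero: "2 \<le> k \<Longrightarrow> i < k \<Longrightarrow> vec_w k $ i \<noteq> 0"
proof (induction k arbitrary: i rule: less_induct)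
  case (less k)
  have i4: "i = 0 \<or> i = 1 \<or> i = 2 \<or> i = 3" if "i < 4" using that by auto
  show ?case
  proof (cases "even k \<and> k > 4")
    case True
    then have k: "k div 2 < k" "2 \<le> k div 2" "i mod (k div 2) < k div 2" by auto
    from less.IH[OF k] True less.prems show ?thesis by (subst vec_w.simps) auto
  next
    case False
    then have "odd k \<or> k = 2 \<or> k = 4"
      using less.prems by (cases "k = 3") presburger+
    then show ?thesis using less.prems i4
      by (subst vec_w.simps) (auto simp: less_Suc_eq numeral_eq_Suc)
  qed
qed

lemma vec_w_signs: "2 \<le> k \<Longrightarrow> (\<exists>i<k. vec_w k $ i > 0) \<and> (\<exists>i<k. vec_w k $ i < 0)"
proof (induction k rule: less_induct)
  case (less k)
  show ?case
  proof (cases "even k \<and> k > 4")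
    case True
    then have k: "k div 2 < k" "2 \<le> k div 2" by auto
    from less.IH[OF k] obtain i j where
      ij: "i < k div 2" "vec_w (k div 2) $ i > 0" "j < k div 2" "vec_w (k div 2) $ j < 0" by auto
    have "vec_w k $ i > 0" "vec_w k $ j < 0" using ij k True by (subst vec_w.simps, auto)+
    then show ?thesis using ij k by (meson less_trans)
  next
    case False
    then have "odd k \<or> k = 2 \<or> k = 4"
      using less.prems by (cases "k = 3") presburger+
    then have "vec_w k $ 0 > 0 \<and> vec_w k $ 1 < 0"
      using less.prems odd_pos by (subst (1 2) vec_w.simps) auto
    then show ?thesis using less.prems by (metis less_le_trans one_less_numeral_iff semiring_norm(76) zero_less_numeral)
  qed
qed

lemma place_w_idx:
  assumes "S \<subseteq> {..<n}" and "card S \<ge> 2"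
  shows "pos_idx (place_w n S) \<union> neg_idx (place_w n S) = S"
    and "pos_idx (place_w n S) \<noteq> {}" and "neg_idx (place_w n S) \<noteq> {}"
    and "card (pos_idx (place_w n S)) + card (neg_idx (place_w n S)) = card S"
proof -
  let ?u = "place_w n S" and ?xs = "sorted_list_of_set S"
  have fin: "finite S" using assms(1) finite_subset by blast
  have rank: "card {j \<in> S. j < i} < card S" if "i \<in> S" for i
    using that fin by (intro psubset_card_mono) auto
  have nz: "?u $ i \<noteq> 0 \<longleftrightarrow> i \<in> S" if "i < n" for i
    using that rank[of i] vec_w_nonzero[OF assms(2)] by (auto simp: place_w_def)
  have "(i \<in> pos_idx ?u \<union> neg_idx ?u) \<longleftrightarrow> i < n \<and> ?u $ i \<noteq> 0" for i
    by (auto simp: pos_idx_def neg_idx_def place_w_def)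
  with nz show un: "pos_idx ?u \<union> neg_idx ?u = S" using assms(1) by blast
  obtain r s where rs: "r < card S" "vec_w (card S) $ r > 0" "s < card S" "vec_w (card S) $ s < 0"
    using vec_w_signs[OF assms(2)] by auto
  have "?xs ! r < n" "?xs ! s < n"
    using rs fin assms(1) nth_mem[of _ ?xs] by auto
  with rs place_w_nth[OF assms(1)]
  show "pos_idx ?u \<noteq> {}" "neg_idx ?u \<noteq> {}"
    by (auto simp: pos_idx_def neg_idx_def place_w_def[of n S] simp del: index_vec)
  show "card (pos_idx ?u) + card (neg_idx ?u) = card S"
    using card_Un_disjoint[OF finite_idx(1)[of ?u] finite_idx(2)[of ?u] idx_disjoint] un by simp
qed

(* A missing child is the empty tree Leaf; the vertices of the tree are the Nodes. *)
function label_tree :: "real vec \<Rightarrow> real vec tree" where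
  "label_tree u = Node
     (if card (pos_idx u) \<ge> 2 then label_tree (place_w (dim_vec u) (pos_idx u)) else Leaf)
     u
     (if card (neg_idx u) \<ge> 2 then label_tree (place_w (dim_vec u) (neg_idx u)) else Leaf)"
  by pat_completeness auto
termination
proof (relation "measure (\<lambda>u. 2 * (card (pos_idx u) + card (neg_idx u)) +
    (if pos_idx u = {} \<or> neg_idx u = {} then 1 else 0))", goal_cases)
  case (2 u)
  have "pos_idx u \<subseteq> {..<dim_vec u}" by (auto simp: pos_idx_def)
  note * = place_w_idx[OF this 2]
  show ?case using *(2-4) card_gt_0_iff[of "neg_idx u"] by auto
next
  case (3 u)
  have "neg_idx u \<subseteq> {..<dim_vec u}" by (auto simp: neg_idx_def)
  note * = place_w_idx[OF this 3]
  show ?case using *(2-4) card_gt_0_iff[of "pos_idx u"] by auto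
qed auto

declare label_tree.simps [simp del]

definition tree_T :: "nat \<Rightarrow> real vec tree" where
  "tree_T n = label_tree (vec_w n)"

lemma size_label_tree:
  "pos_idx u \<noteq> {} \<Longrightarrow> neg_idx u \<noteq> {} \<Longrightarrow>
   size (label_tree u) + 1 = card (pos_idx u) + card (neg_idx u)"
proof (induction u rule: label_tree.induct)
  case (1 u)
  have sub: "pos_idx u \<subseteq> {..<dim_vec u}" "neg_idx u \<subseteq> {..<dim_vec u}"
    by (auto simp: pos_idx_def neg_idx_def)
  have p: "(if card (pos_idx u) \<ge> 2 then size (label_tree (place_w (dim_vec u) (pos_idx u))) else 0) + 1
      = card (pos_idx u)"
    using 1(1) place_w_idx[OF sub(1)] 1(3) card_gt_0_iff[of "pos_idx u"] by auto
  have q: "(if card (neg_idx u) \<ge> 2 then size (label_tree (place_w (dim_vec u) (neg_idx u))) else 0) + 1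
      = card (neg_idx u)"
    using 1(2) place_w_idx[OF sub(2)] 1(4) card_gt_0_iff[of "neg_idx u"] by auto
  show ?case unfolding label_tree.simps[of u] using p q by (auto split: if_splits)
qed

lemma length_preorder_tree_T:
  assumes "n \<ge> 2"
  shows "length (preorder (tree_T n)) = n - 1"
proof -
  let ?u = "vec_w n"
  have "pos_idx ?u \<union> neg_idx ?u = {..<n}"
    using vec_w_nonzero[OF assms] by (auto simp: pos_idx_def neg_idx_def linorder_neq_iff)
  then have "card (pos_idx ?u) + card (neg_idx ?u) = n"
    using card_Un_disjoint[OF finite_idx(1)[of ?u] finite_idx(2)[of ?u] idx_disjoint] by simp
  moreover have "pos_idx ?u \<noteq> {}" "neg_idx ?u \<noteq> {}"
    using vec_w_signs[OF assms] by (auto simp: pos_idx_def neg_idx_def)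
  ultimately show ?thesis using size_label_tree[of ?u] by (simp add: tree_T_def)
qed

definition set_U :: "nat \<Rightarrow> real vec set" where
  "set_U n = {preorder (tree_T n) ! i |i. i < n - 1}"

definition outer_prod :: "real vec \<Rightarrow> real vec \<Rightarrow> real mat" where
  "outer_prod a b = mat (dim_vec a) (dim_vec b) (\<lambda>(i, j). a $ i * b $ j)"

definition zero_sum_space :: "nat \<Rightarrow> nat \<Rightarrow> (real, real mat) module" where
  "zero_sum_space m n = (module_mat TYPE(real) m n)
     \<lparr>carrier := {X \<in> carrier_mat m n.
        (\<forall>i<m. (\<Sum>k<n. X $$ (i, k)) = 0) \<and> (\<forall>j<n. (\<Sum>k<m. X $$ (k, j)) = 0)}\<rparr>"

lemma zero_sum_subspace:
  "subspace class_ring (carrier (zero_sum_space m n)) (module_mat TYPE(real) m n)"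
  unfolding subspace_def
proof (intro conjI matrix_vs submodule.intro)
  show "Module.module class_ring (module_mat TYPE(real) m n)"
    using matrix_vs[of m n, where 'a = real] by (simp add: vectorspace_def)
qed (auto simp: zero_sum_space_def module_mat_simps class_ring_simps
      sum.distrib sum_distrib_left [symmetric])

lemma vectorspace_zero_sum_space: "vectorspace class_ring (zero_sum_space m n)"
  using vectorspace.subspace_is_vs[OF matrix_vs zero_sum_subspace[of m n]]
  by (simp add: zero_sum_space_def)

definition frobenius :: "real mat \<Rightarrow> real mat \<Rightarrow> real" where
  "frobenius X Y = (\<Sum>i<dim_row X. \<Sum>j<dim_col X. X $$ (i, j) * Y $$ (i, j))"

definition set_B :: "nat \<Rightarrow> nat \<Rightarrow> real mat set" where
  "set_B m n = {outer_prod u u' |u u'. u \<in> set_U m \<and> u' \<in> set_U n}"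

definition orthogonal_basis :: "(real, real mat) module \<Rightarrow> real mat set \<Rightarrow> bool" where
  "orthogonal_basis V A \<longleftrightarrow>
     vectorspace.basis class_ring V A \<and> pairwise (\<lambda>X Y. frobenius X Y = 0) A"

end

theory Submission
  imports Defs
begin

text \<open>
  Every label of $T_n$ sums to zero and takes one constant value on its positive coordinates and
  another one on its negative coordinates, while the labels in its left (right) subtree are zero-sum
  and supported on the positive (negative) coordinates. Hence distinct labels are orthogonal.
  Completeness needs no dimension count: if $u$ is a label with support $S = P \<union> N$, then
  \<open>u u\<^sup>T / |u|\<^sup>2\<close> equals \<open>1\<^sub>P 1\<^sub>P\<^sup>T / |P| + 1\<^sub>N 1\<^sub>N\<^sup>T / |N| - 1\<^sub>S 1\<^sub>S\<^sup>T / |S|\<close>, so the sum of these matrices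
  over a subtree telescopes to the orthogonal projection \<open>I\<^sub>S - 1\<^sub>S 1\<^sub>S\<^sup>T / |S|\<close> onto the zero-sum
  vectors supported on $S$. Applying the projections for $U(m)$ and $U(n)$ to the two sides of a
  matrix in $V_{m,n}$ expands that matrix in $B_{m,n}$.
\<close>

section \<open>Labels as zero-sum vectors with one positive and one negative value\<close>

definition balanced :: "real vec \<Rightarrow> bool" where
  "balanced u \<longleftrightarrow> pos_idx u \<noteq> {} \<and> neg_idx u \<noteq> {} \<and> (\<Sum>i<dim_vec u. u $ i) = 0 \<and>
     (\<exists>a>0. \<exists>b>0. \<forall>i<dim_vec u. u $ i \<in> {a, 0, - b})"

lemma sum_lessThan_double:
  fixes f :: "nat \<Rightarrow> real"
  shows "(\<Sum>i<2 * m. f (i mod m)) = 2 * (\<Sum>i<m. f i)"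
proof -
  \<comment> \<open>Letting the second period be cut off at \<open>k\<close> makes induction on
    \<open>k\<close> possible.\<close>
  have "(\<Sum>i<m + k. f (i mod m)) = (\<Sum>i<m. f i) + (\<Sum>i<k. f i)" if "k \<le> m" for k
    using that by (induction k) auto
  from this[of m] show ?thesis unfolding mult_2 by simp
qed

lemma sum_vec_w_odd: "(\<Sum>i<2 * l + 1. if even i then real l else - (real l + 1)) = 0"
proof -
  \<comment> \<open>Each pair of neighbours contributes c - (c + 1) = -1. The constant is decoupled
    from \<open>l\<close> so that it stays fixed during the induction; for c = l the last term, at
    the even index 2 * l, cancels the total.\<close>
  have *: "(\<Sum>i<2 * l. if even i then c else - (c + 1)) = - real l" for c
    by (induction l) auto
  then show "(\<Sum>i<2 * l + 1. if even i then real l else - (real l + 1)) = 0"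
    using *[of "real l"] by simp
qed

lemma vec_w_two_valued_sum_0:
  "2 \<le> k \<Longrightarrow> (\<Sum>i<k. vec_w k $ i) = 0 \<and> (\<exists>a>0. \<exists>b>0. \<forall>i<k. vec_w k $ i \<in> {a, - b})"
proof (induction k rule: less_induct)
  case (less k)
  consider (double) "even k" "k > 4" | (odd) "odd k" | (two) "k = 2" | (four) "k = 4"
  proof -
    have "odd k \<or> k = 2 \<or> k = 4 \<or> even k \<and> k > 4"
      using less.prems by presburger
    then show ?thesis using that by blast
  qed
  then show ?case
  proof cases
    case double
    define h where "h = k div 2"
    have k: "h < k" "2 \<le> h" "k = 2 * h" using double by (auto simp: h_def)
    have w: "vec_w k $ i = vec_w h $ (i mod h)" if "i < k" for i
      using that double by (subst vec_w.simps) (auto simp: h_def)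
    have "(\<Sum>i<k. vec_w k $ i) = (\<Sum>i<2 * h. vec_w h $ (i mod h))"
      using w k(3) by simp
    then have "(\<Sum>i<k. vec_w k $ i) = 0"
      using less.IH[OF k(1,2)] by (simp add: sum_lessThan_double)
    moreover have "i mod h < h" for i using k by simp
    ultimately show ?thesis using less.IH[OF k(1,2)] w by metis
  next
    case odd
    then obtain l where l: "k = 2 * l + 1" by (elim oddE)
    have w: "vec_w k $ i = (if even i then real l else - (real l + 1))" if "i < k" for i
      using that odd l by (subst vec_w.simps) auto
    have "(\<Sum>i<k. vec_w k $ i) = 0"
      using sum_vec_w_odd[of l] w by (simp add: l)
    moreover have "real l > 0" using l less.prems by auto
    ultimately show ?thesis using w
      by (intro conjI exI[of _ "real l"] exI[of _ "real l + 1"]) auto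
  next
    case two
    have "vec_w 2 = vec_of_list [1, - 1]" by (subst vec_w.simps) simp
    with two show ?thesis
      by (intro conjI exI[of _ 1]) (auto simp: numeral_eq_Suc less_Suc_eq)
  next
    case four
    have "vec_w 4 = vec_of_list [1, - 1, - 1, 1]" by (subst vec_w.simps) simp
    with four show ?thesis
      by (intro conjI exI[of _ 1]) (auto simp: numeral_eq_Suc less_Suc_eq)
  qed
qed

lemma balanced_vec_w:
  assumes "2 \<le> k"
  shows "balanced (vec_w k)"
proof -
  obtain a b where "a > 0" "b > 0" "\<And>i. i < k \<Longrightarrow> vec_w k $ i \<in> {a, - b}"
    using vec_w_two_valued_sum_0[OF assms] by blast
  then have "\<exists>a>0. \<exists>b>0. \<forall>i<k. vec_w k $ i \<in> {a, 0, - b}"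
    by blast
  then show ?thesis
    using vec_w_signs[OF assms] vec_w_two_valued_sum_0[OF assms]
    unfolding balanced_def pos_idx_def neg_idx_def by simp
qed

lemma dim_place_w [simp]: "dim_vec (place_w n S) = n"
  by (simp add: place_w_def)

text \<open>Enumerating \<open>S\<close> in increasing order turns the entries on \<open>S\<close>
  into those of \<open>vec_w (card S)\<close>, and all other entries are zero, so sum and values
  carry over.\<close>

lemma balanced_place_w:
  assumes S: "S \<subseteq> {..<n}" and card: "card S \<ge> 2"
  shows "balanced (place_w n S)"
proof -
  let ?xs = "sorted_list_of_set S" and ?u = "place_w n S"
  have fin: "finite S" using S finite_subset by blast
  have bij: "bij_betw (\<lambda>r. ?xs ! r) {..<card S} S"
    using fin by (intro bij_betw_nth) auto
  have zero: "?u $ i = 0" if "i < n" "i \<notin> S" for i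
    using that by (simp add: place_w_def)
  have "(\<Sum>i<n. ?u $ i) = (\<Sum>i\<in>S. ?u $ i)"
    using S zero by (intro sum.mono_neutral_right) auto
  also have "\<dots> = (\<Sum>r<card S. vec_w (card S) $ r)"
    using place_w_nth[OF S] by (simp add: sum.reindex_bij_betw[OF bij, symmetric])
  also have "\<dots> = 0" using vec_w_two_valued_sum_0[OF card] by blast
  finally have sum: "(\<Sum>i<n. ?u $ i) = 0" .
  obtain a b where ab: "a > 0" "b > 0" "\<And>i. i < card S \<Longrightarrow> vec_w (card S) $ i \<in> {a, - b}"
    using vec_w_two_valued_sum_0[OF card] by blast
  have "?u $ i \<in> {a, 0, - b}" if "i < n" for i
  proof (cases "i \<in> S")
    case True
    then obtain r where "r < card S" "i = ?xs ! r" using bij by (auto simp: bij_betw_def)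
    then show ?thesis using ab(3) place_w_nth[OF S] by auto
  qed (use zero that in auto)
  then have "\<exists>a>0. \<exists>b>0. \<forall>i<n. ?u $ i \<in> {a, 0, - b}"
    using ab(1,2) by blast
  then show ?thesis
    using place_w_idx[OF assms] sum unfolding balanced_def by simp
qed

section \<open>Complete orthogonal systems on a set of coordinates\<close>

text \<open>For an orthogonal family of nonzero vectors this is the matrix of the orthogonal
  projection onto their span.\<close>

definition proj_kernel :: "real vec set \<Rightarrow> nat \<Rightarrow> nat \<Rightarrow> real" where
  "proj_kernel V i j = (\<Sum>v\<in>V. v $ i * v $ j / (v \<bullet> v))"

text \<open>The last clause expresses completeness: on \<open>S\<close> the kernel is that of the
  projection onto the zero-sum vectors supported on \<open>S\<close>. At indices below
  \<open>n\<close> outside \<open>S\<close> the support clause already makes the kernel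
  vanish.\<close>

definition orth_system :: "nat \<Rightarrow> nat set \<Rightarrow> real vec set \<Rightarrow> bool" where
  "orth_system n S U \<longleftrightarrow> finite U \<and>
     (\<forall>v\<in>U. dim_vec v = n \<and> v \<bullet> v \<noteq> 0 \<and> (\<Sum>i<n. v $ i) = 0 \<and> (\<forall>i<n. i \<notin> S \<longrightarrow> v $ i = 0)) \<and>
     pairwise (\<lambda>v w. v \<bullet> w = 0) U \<and>
     (\<forall>i\<in>S. \<forall>j\<in>S. proj_kernel U i j = of_bool (i = j) - 1 / card S)"

lemma scalar_prod_eq_sum: "dim_vec w = n \<Longrightarrow> v \<bullet> w = (\<Sum>i<n. v $ i * w $ i)"
  by (simp add: scalar_prod_def atLeast0LessThan)

text \<open>The case of a missing child: a zero-sum vector on one coordinate is zero, so the empty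
  family is complete, in agreement with 1 - 1/1 = 0.\<close>

lemma orth_system_singleton: "orth_system n {i} {}"
  by (simp add: orth_system_def proj_kernel_def)

text \<open>Since \<open>u\<close> is constant on each block, zero-sum vectors supported on one
  block are orthogonal to it. The zero sum of \<open>u\<close> gives a : b = q : p, and this ratio
  makes the rank-one kernel of \<open>u\<close> merge the kernels of the two blocks into that of
  their union.\<close>

lemma orth_system_node:
  assumes u: "balanced u" and dim: "dim_vec u = n"
    and L: "orth_system n (pos_idx u) L" and R: "orth_system n (neg_idx u) R"
  shows "orth_system n (pos_idx u \<union> neg_idx u) (insert u (L \<union> R))"
proof -
  define P N p q where "P = pos_idx u" and "N = neg_idx u"
    and "p = real (card (pos_idx u))" and "q = real (card (neg_idx u))"
  have fin: "finite P" "finite N" and disj: "P \<inter> N = {}" and sub: "P \<subseteq> {..<n}" "N \<subseteq> {..<n}"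
    using idx_disjoint dim by (auto simp: P_def N_def pos_idx_def neg_idx_def)
  have pq: "p > 0" "q > 0" using u by (auto simp: p_def q_def balanced_def card_gt_0_iff)
  obtain a b where a: "a > 0" and b: "b > 0" and ab: "\<And>i. i < n \<Longrightarrow> u $ i \<in> {a, 0, - b}"
    using u dim unfolding balanced_def by blast
  have uP: "u $ i = a" if "i \<in> P" for i
    using ab[of i] a b that dim by (auto simp: P_def pos_idx_def)
  have uN: "u $ i = - b" if "i \<in> N" for i
    using ab[of i] a b that dim by (auto simp: N_def neg_idx_def)
  have u0: "u $ i = 0" if "i < n" "i \<notin> P \<union> N" for i
    using that dim by (auto simp: P_def N_def pos_idx_def neg_idx_def)
  \<comment> \<open>Used with the identity for the zero sum and with the square for the norm;
    \<open>f 0 = 0\<close> discards the coordinates outside both blocks.\<close>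
  have sum_split: "(\<Sum>i<n. f (u $ i) * g i) = f a * (\<Sum>i\<in>P. g i) + f (- b) * (\<Sum>i\<in>N. g i)"
    if "f 0 = 0" for f g :: "_ \<Rightarrow> real"
  proof -
    have "(\<Sum>i<n. f (u $ i) * g i) = (\<Sum>i\<in>P \<union> N. f (u $ i) * g i)"
      using sub u0 that by (intro sum.mono_neutral_right) auto
    also have "\<dots> = (\<Sum>i\<in>P. f (u $ i) * g i) + (\<Sum>i\<in>N. f (u $ i) * g i)"
      by (rule sum.union_disjoint[OF fin disj])
    finally show ?thesis by (simp add: uP uN sum_distrib_left)
  qed
  have "(\<Sum>i<n. u $ i) = 0" using u dim by (simp add: balanced_def)
  then have bal: "p * a = q * b"
    using sum_split[of "\<lambda>x. x" "\<lambda>_. 1"] by (simp add: p_def q_def P_def N_def mult.commute)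
  have "u \<bullet> u = p * a^2 + q * b^2"
    using sum_split[of "\<lambda>x. x^2" "\<lambda>_. 1"] scalar_prod_eq_sum[OF dim, of u]
    by (simp add: p_def q_def P_def N_def power2_eq_square mult.commute)
  also have "\<dots> = (p * a) * a + (q * b) * b" by (simp add: power2_eq_square)
  \<comment> \<open>Exchanging the equal products p * a and q * b produces the factor a * b in both
    summands.\<close>
  also have "\<dots> = (q * b) * a + (p * a) * b" by (simp only: bal)
  also have "\<dots> = a * b * (p + q)" by (simp add: algebra_simps)
  finally have uu: "u \<bullet> u = a * b * (p + q)" .
  then have uu0: "u \<bullet> u \<noteq> 0" using a b pq by simp
  have child: "dim_vec v = n" "v \<bullet> v \<noteq> 0" "(\<Sum>i<n. v $ i) = 0" "\<And>i. i < n \<Longrightarrow> i \<notin> S \<Longrightarrow> v $ i = 0"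
    if "orth_system n S V" "v \<in> V" for S V v
    using that unfolding orth_system_def by blast+
  have orth_child: "u \<bullet> v = 0"
    if V: "orth_system n S V" and v: "v \<in> V" and const: "\<And>i. i \<in> S \<Longrightarrow> u $ i = c" for S V v c
  proof -
    have "u \<bullet> v = (\<Sum>i<n. c * v $ i)"
      unfolding scalar_prod_eq_sum[OF child(1)[OF V v]]
      by (intro sum.cong refl) (use child(4)[OF V v] const in force)
    also have "\<dots> = 0" using child(3)[OF V v] by (simp flip: sum_distrib_left)
    finally show ?thesis .
  qed
  have uL: "u \<bullet> v = 0" if "v \<in> L" for v using orth_child[OF L that] uP by (auto simp: P_def)
  have uR: "u \<bullet> v = 0" if "v \<in> R" for v using orth_child[OF R that] uN by (auto simp: N_def)
  have LR: "v \<bullet> w = 0" if "v \<in> L" "w \<in> R" for v w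
    unfolding scalar_prod_eq_sum[OF child(1)[OF R that(2)]]
    using child(4)[OF L that(1)] child(4)[OF R that(2)] disj
    by (intro sum.neutral) (auto simp: P_def N_def)
  have finLR: "finite L" "finite R" using L R by (auto simp: orth_system_def)
  have dims: "dim_vec v = n" if "v \<in> insert u (L \<union> R)" for v
    using that dim child(1)[OF L] child(1)[OF R] by blast
  have pw: "pairwise (\<lambda>v w. v \<bullet> w = 0) (insert u (L \<union> R))"
  proof (rule pairwiseI)
    fix v w assume vw: "v \<in> insert u (L \<union> R)" "w \<in> insert u (L \<union> R)" "v \<noteq> w"
    have comm: "v \<bullet> w = w \<bullet> v" by (rule comm_scalar_prod[of _ n]) (use vw dims in \<open>auto intro: carrier_vecI\<close>)
    have "v \<bullet> w = 0" if "v \<in> L \<and> w \<in> L \<or> v \<in> R \<and> w \<in> R"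
      using L R that vw(3) unfolding orth_system_def pairwise_def by blast
    moreover have "v \<bullet> w = 0" if "v = u" using that vw uL uR by auto
    moreover have "v \<bullet> w = 0" if "w = u" unfolding comm using that vw uL uR by auto
    moreover have "v \<bullet> w = 0" if "v \<in> L \<and> w \<in> R" using that LR by simp
    moreover have "v \<bullet> w = 0" if "v \<in> R \<and> w \<in> L" unfolding comm using that LR by simp
    ultimately show "v \<bullet> w = 0" using vw(1,2) by blast
  qed
  have split: "(\<Sum>v\<in>insert u (L \<union> R). f v) = f u + (\<Sum>v\<in>L. f v) + (\<Sum>v\<in>R. f v)"
    for f :: "real vec \<Rightarrow> real"
  proof -
    \<comment> \<open>A vector occurring twice would be orthogonal to itself, against the nonzero
      norms.\<close>
    have "u \<notin> L \<union> R" "L \<inter> R = {}" using uL uR uu0 LR child(2)[OF L] by blast+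
    then show ?thesis using finLR by (simp add: sum.union_disjoint)
  qed
  have K_in: "proj_kernel L i j = of_bool (i = j) - 1 / p" if "i \<in> P" "j \<in> P" for i j
    using that L by (auto simp: p_def P_def orth_system_def)
  have K_in': "proj_kernel R i j = of_bool (i = j) - 1 / q" if "i \<in> N" "j \<in> N" for i j
    using that R by (auto simp: q_def N_def orth_system_def)
  have K0: "proj_kernel V i j = 0" if "orth_system n S V" "i < n" "j < n" "i \<notin> S \<or> j \<notin> S" for V S i j
    unfolding proj_kernel_def using child(4)[OF that(1)] that(2-4) by (intro sum.neutral) auto
  have KL0: "proj_kernel L i j = 0" if "i \<in> N \<or> j \<in> N" "i < n" "j < n" for i j
    using K0[OF L] that disj by (auto simp: P_def N_def)
  have KR0: "proj_kernel R i j = 0" if "i \<in> P \<or> j \<in> P" "i < n" "j < n" for i j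
    using K0[OF R] that disj by (auto simp: P_def N_def)
  have card: "real (card (P \<union> N)) = p + q"
    using card_Un_disjoint[OF fin disj] by (simp add: p_def q_def P_def N_def)
  have ratio: "a / b = q / p" "b / a = p / q" using bal a b pq by (simp_all add: field_simps)
  have "a * a / (u \<bullet> u) = (a / b) / (p + q)" "b * b / (u \<bullet> u) = (b / a) / (p + q)"
    unfolding uu using a b by simp_all
  moreover have "q / p / (p + q) - 1 / p = - 1 / (p + q)" "p / q / (p + q) - 1 / q = - 1 / (p + q)"
    using pq add_pos_pos[OF pq] by (simp_all add: divide_simps)
  \<comment> \<open>Within a block, \<open>u\<close> corrects the term 1/p or 1/q of the child to
    1/(p + q). On mixed entries both child kernels vanish and \<open>u\<close> alone supplies -1/(p
    + q).\<close>
  ultimately have PP: "a * a / (u \<bullet> u) - 1 / p = - 1 / (p + q)"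
    and NN: "b * b / (u \<bullet> u) - 1 / q = - 1 / (p + q)"
    unfolding ratio by simp_all
  have PN: "a * b / (u \<bullet> u) = 1 / (p + q)"
    unfolding uu using a b by simp
  have "proj_kernel (insert u (L \<union> R)) i j = of_bool (i = j) - 1 / card (P \<union> N)"
    if ij: "i \<in> P \<union> N" "j \<in> P \<union> N" for i j
  proof -
    have n: "i < n" "j < n" using ij sub by auto
    have "proj_kernel (insert u (L \<union> R)) i j = u $ i * u $ j / (u \<bullet> u) + proj_kernel L i j + proj_kernel R i j"
      unfolding proj_kernel_def by (rule split)
    moreover have "i \<noteq> j" if "i \<in> P \<and> j \<in> N \<or> i \<in> N \<and> j \<in> P" using that disj by auto
    ultimately show ?thesis
      using ij n PP NN PN unfolding card
      by (auto simp: uP uN K_in K_in' KL0 KR0 mult.commute)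
  qed
  then show ?thesis
    unfolding orth_system_def
    using pw finLR dims uu0 \<open>(\<Sum>i<n. u $ i) = 0\<close> child[OF L] child[OF R] u0
    by (auto simp: P_def N_def)
qed

text \<open>Induction along the tree: a child placed on a block has exactly that block as support by
  \<open>place_w_idx\<close>, so its system fits into \<open>orth_system_node\<close>; a missing
  child belongs to a singleton block.\<close>

lemma orth_system_label_tree:
  "balanced u \<Longrightarrow> orth_system (dim_vec u) (pos_idx u \<union> neg_idx u) (set_tree (label_tree u))"
proof (induction u rule: label_tree.induct)
  case (1 u)
  have sub: "pos_idx u \<subseteq> {..<dim_vec u}" "neg_idx u \<subseteq> {..<dim_vec u}"
    by (auto simp: pos_idx_def neg_idx_def)
  \<comment> \<open>The induction hypothesis is made a premise, so that one argument serves the left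
    and the right child.\<close>
  have child: "orth_system (dim_vec u) S (set_tree (if card S \<ge> 2 then label_tree (place_w (dim_vec u) S) else Leaf))"
    if "S \<subseteq> {..<dim_vec u}" "S \<noteq> {}"
      and IH: "card S \<ge> 2 \<Longrightarrow> balanced (place_w (dim_vec u) S) \<Longrightarrow>
        orth_system (dim_vec (place_w (dim_vec u) S))
          (pos_idx (place_w (dim_vec u) S) \<union> neg_idx (place_w (dim_vec u) S))
          (set_tree (label_tree (place_w (dim_vec u) S)))" for S
  proof (cases "card S \<ge> 2")
    case True
    then show ?thesis
      using IH balanced_place_w[OF that(1)] place_w_idx(1)[OF that(1)] by simp
  next
    case False
    moreover have "card S \<noteq> 0" using that finite_subset by fastforce
    ultimately have "card S = 1" by linarith
    then obtain i where "S = {i}" by (rule card_1_singletonE)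
    then show ?thesis by (simp add: orth_system_singleton)
  qed
  have ne: "pos_idx u \<noteq> {}" "neg_idx u \<noteq> {}" using 1(3) by (auto simp: balanced_def)
  have "set_tree (label_tree u) = insert u
      (set_tree (if card (pos_idx u) \<ge> 2 then label_tree (place_w (dim_vec u) (pos_idx u)) else Leaf) \<union>
       set_tree (if card (neg_idx u) \<ge> 2 then label_tree (place_w (dim_vec u) (neg_idx u)) else Leaf))"
    by (subst label_tree.simps) simp
  then show ?case
    using orth_system_node[OF 1(3) refl child[OF sub(1) ne(1) 1(1)] child[OF sub(2) ne(2) 1(2)]]
    by simp
qed

lemma orth_system_set_U:
  assumes "n \<ge> 2"
  shows "orth_system n {..<n} (set_U n)"
proof -
  \<comment> \<open>The traversal has length exactly n - 1, so the index bound in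
    \<open>set_U\<close> omits no vertex.\<close>
  have "set_U n = set (preorder (tree_T n))"
    unfolding set_U_def set_conv_nth length_preorder_tree_T[OF assms] by blast
  moreover have "pos_idx (vec_w n) \<union> neg_idx (vec_w n) = {..<n}"
    using vec_w_nonzero[OF assms] by (auto simp: pos_idx_def neg_idx_def linorder_neq_iff)
  ultimately show ?thesis
    using orth_system_label_tree[OF balanced_vec_w[OF assms]] by (simp add: tree_T_def)
qed

section \<open>Orthogonal bases of the zero-sum space from an expansion formula\<close>

lemma carrier_zero_sum_space:
  "carrier (zero_sum_space m n) = {X \<in> carrier_mat m n.
     (\<forall>i<m. (\<Sum>k<n. X $$ (i, k)) = 0) \<and> (\<forall>j<n. (\<Sum>k<m. X $$ (k, j)) = 0)}"
  by (simp add: zero_sum_space_def)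

lemma zero_sum_space_simps:
  "add (zero_sum_space m n) = (+)" "zero (zero_sum_space m n) = 0\<^sub>m m n"
  "smult (zero_sum_space m n) = (\<cdot>\<^sub>m)"
  by (simp_all add: zero_sum_space_def module_mat_simps)

lemma lincomb_zero_sum_space_index:
  assumes "finite A" "A \<subseteq> carrier (zero_sum_space m n)" "i < m" "j < n"
  shows "module.lincomb (zero_sum_space m n) a A $$ (i, j) = (\<Sum>X\<in>A. a X * X $$ (i, j))"
proof -
  interpret V: vectorspace class_ring "zero_sum_space m n" by (rule vectorspace_zero_sum_space)
  from assms(1,2) show ?thesis
  proof (induction A)
    case empty
    then show ?case using assms(3,4) by (simp add: V.lincomb_def zero_sum_space_simps)
  next
    case (insert X A)
    have "V.lincomb a A \<in> carrier (zero_sum_space m n)"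
      using insert by (intro V.lincomb_closed) (auto simp: class_ring_simps)
    moreover have "V.lincomb a (insert X A) = a X \<cdot>\<^sub>m X + V.lincomb a A"
      using insert
      by (subst V.lincomb_insert2) (auto simp: class_ring_simps zero_sum_space_simps)
    ultimately show ?case
      using insert assms(3,4) by (auto simp: carrier_zero_sum_space)
  qed
qed

text \<open>Pairing a vanishing combination with one of its members isolates that member's
  coefficient, which gives independence. The expansion of each \<open>X\<close> with its Fourier
  coefficients gives the span.\<close>

lemma orthogonal_basis_zero_sum_spaceI:
  assumes fin: "finite B" and sub: "B \<subseteq> carrier (zero_sum_space m n)"
    and orth: "pairwise (\<lambda>X Y. frobenius X Y = 0) B"
    and nz: "\<And>M. M \<in> B \<Longrightarrow> frobenius M M \<noteq> 0"
    and expand: "\<And>X i j. X \<in> carrier (zero_sum_space m n) \<Longrightarrow> i < m \<Longrightarrow> j < n \<Longrightarrow>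
      X $$ (i, j) = (\<Sum>M\<in>B. frobenius X M / frobenius M M * M $$ (i, j))"
  shows "orthogonal_basis (zero_sum_space m n) B"
proof -
  interpret V: vectorspace class_ring "zero_sum_space m n" by (rule vectorspace_zero_sum_space)
  have "V.lin_indpt B"
  proof
    assume "V.lin_dep B"
    then obtain A a Y where A: "finite A" "A \<subseteq> B" "Y \<in> A" "a Y \<noteq> 0"
      and zero: "V.lincomb a A = 0\<^sub>m m n"
      unfolding V.lin_dep_def by (auto simp: zero_sum_space_simps class_ring_simps)
    have dims: "dim_row X = m" "dim_col X = n" if "X \<in> A" for X
      using that A(2) sub by (auto simp: carrier_zero_sum_space)
    have "(\<Sum>X\<in>A. a X * X $$ (i, j)) = 0" if "i < m" "j < n" for i j
      using lincomb_zero_sum_space_index[OF A(1) _ that, of a] zero A(2) sub that by simp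
    \<comment> \<open>This is the Frobenius product of the vanishing combination with
      \<open>Y\<close>; the sum over \<open>A\<close> is then pulled outside.\<close>
    then have "0 = (\<Sum>i<m. \<Sum>j<n. (\<Sum>X\<in>A. a X * X $$ (i, j)) * Y $$ (i, j))" by simp
    also have "\<dots> = (\<Sum>i<m. \<Sum>j<n. \<Sum>X\<in>A. a X * (X $$ (i, j) * Y $$ (i, j)))"
      by (simp add: sum_distrib_right mult.assoc)
    also have "\<dots> = (\<Sum>i<m. \<Sum>X\<in>A. \<Sum>j<n. a X * (X $$ (i, j) * Y $$ (i, j)))"
      by (intro sum.cong refl sum.swap)
    also have "\<dots> = (\<Sum>X\<in>A. \<Sum>i<m. \<Sum>j<n. a X * (X $$ (i, j) * Y $$ (i, j)))"
      by (rule sum.swap)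
    also have "\<dots> = (\<Sum>X\<in>A. a X * frobenius X Y)"
      by (intro sum.cong refl) (simp add: frobenius_def dims sum_distrib_left)
    also have "\<dots> = a Y * frobenius Y Y"
    proof (subst sum.remove[OF A(1,3)], subst sum.neutral)
      show "\<forall>X\<in>A - {Y}. a X * frobenius X Y = 0"
        using A(2,3) by (auto intro!: pairwiseD[OF orth])
    qed simp
    finally show False using A nz by auto
  qed
  moreover have "V.span B = carrier (zero_sum_space m n)"
  proof (intro equalityI subsetI)
    fix X assume "X \<in> V.span B"
    then show "X \<in> carrier (zero_sum_space m n)" using V.span_closed[OF sub] by blast
  next
    fix X assume X: "X \<in> carrier (zero_sum_space m n)"
    define a where "a M = frobenius X M / frobenius M M" for M
    have lin: "V.lincomb a B \<in> carrier (zero_sum_space m n)"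
      using sub by (intro V.lincomb_closed) (auto simp: class_ring_simps)
    have "X = V.lincomb a B"
    proof (rule eq_matI)
      show "dim_row X = dim_row (V.lincomb a B)" "dim_col X = dim_col (V.lincomb a B)"
        using X lin by (auto simp: carrier_zero_sum_space)
    next
      fix i j assume "i < dim_row (V.lincomb a B)" "j < dim_col (V.lincomb a B)"
      then have "i < m" "j < n" using lin by (auto simp: carrier_zero_sum_space)
      then show "X $$ (i, j) = V.lincomb a B $$ (i, j)"
        unfolding lincomb_zero_sum_space_index[OF fin sub \<open>i < m\<close> \<open>j < n\<close>]
        using expand[OF X] by (simp add: a_def)
    qed
    then show "X \<in> V.span B"
      unfolding V.span_def using fin by (auto simp: class_ring_simps)
  qed
  ultimately show ?thesis
    using sub orth by (simp add: orthogonal_basis_def V.basis_def)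
qed

section \<open>Outer products and the expansion of zero-sum matrices\<close>

lemma frobenius_outer_prod:
  assumes "dim_vec u' = dim_vec u" "dim_vec w' = dim_vec w"
  shows "frobenius (outer_prod u w) (outer_prod u' w') = (u \<bullet> u') * (w \<bullet> w')"
  using assms
  by (simp add: frobenius_def outer_prod_def scalar_prod_def atLeast0LessThan sum_product mult.commute
      mult.left_commute)

lemma frobenius_outer_prod_right:
  assumes "X \<in> carrier_mat (dim_vec u) (dim_vec w)"
  shows "frobenius X (outer_prod u w) = (\<Sum>k<dim_vec u. \<Sum>l<dim_vec w. X $$ (k, l) * (u $ k * w $ l))"
  using assms by (auto simp: frobenius_def outer_prod_def)

text \<open>The centering matrix, identity minus the constant matrix 1/n, fixes zero-sum vectors
  because its constant part sees only their sum.\<close>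

lemma sum_times_centering:
  fixes c :: "nat \<Rightarrow> real"
  assumes "(\<Sum>l<n. c l) = 0" "j < n"
  shows "(\<Sum>l<n. c l * (of_bool (l = j) - 1 / n)) = c j"
proof -
  have "(\<Sum>l<n. c l * (of_bool (l = j) - 1 / n)) =
      (\<Sum>l<n. c l * of_bool (l = j)) - (\<Sum>l<n. c l) * (1 / n)"
    by (simp only: right_diff_distrib sum_subtractf sum_distrib_right)
  also have "(\<Sum>l<n. c l * of_bool (l = j)) = (\<Sum>l<n. if l = j then c l else 0)"
    by (intro sum.cong) auto
  finally show ?thesis using assms by simp
qed

theorem theorem1:
  fixes m n :: nat
  assumes "m \<ge> 2" and "n \<ge> 2"
  shows "orthogonal_basis (zero_sum_space m n) (set_B m n)"
proof (rule orthogonal_basis_zero_sum_spaceI)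
  let ?U = "set_U m" and ?W = "set_U n"
  note orth_systems = orth_system_set_U[OF assms(1)] orth_system_set_U[OF assms(2)]
  have U: "dim_vec u = m" "u \<bullet> u \<noteq> 0" "(\<Sum>i<m. u $ i) = 0" if "u \<in> ?U" for u
    using that orth_systems(1) by (auto simp: orth_system_def)
  have W: "dim_vec w = n" "w \<bullet> w \<noteq> 0" "(\<Sum>i<n. w $ i) = 0" if "w \<in> ?W" for w
    using that orth_systems(2) by (auto simp: orth_system_def)
  have B: "set_B m n = (\<lambda>(u, w). outer_prod u w) ` (?U \<times> ?W)"
    by (auto simp: set_B_def)
  have fin: "finite ?U" "finite ?W" using orth_systems by (auto simp: orth_system_def)
  then show "finite (set_B m n)" by (simp add: B)
  show "set_B m n \<subseteq> carrier (zero_sum_space m n)"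
    by (auto simp: B carrier_zero_sum_space outer_prod_def U W simp flip: sum_distrib_left sum_distrib_right)
  have frob: "frobenius (outer_prod u w) (outer_prod u' w') = (u \<bullet> u') * (w \<bullet> w')"
    if "u \<in> ?U" "u' \<in> ?U" "w \<in> ?W" "w' \<in> ?W" for u u' w w'
    using that by (intro frobenius_outer_prod) (simp_all add: U W)
  have orth: "frobenius (outer_prod u w) (outer_prod u' w') = 0"
    if "u \<in> ?U" "u' \<in> ?U" "w \<in> ?W" "w' \<in> ?W" "u \<noteq> u' \<or> w \<noteq> w'" for u u' w w'
  proof -
    have "u \<bullet> u' = 0 \<or> w \<bullet> w' = 0"
      using orth_systems that unfolding orth_system_def pairwise_def by meson
    then show ?thesis using frob that by auto
  qed
  then show "pairwise (\<lambda>X Y. frobenius X Y = 0) (set_B m n)"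
    by (auto simp: B intro!: pairwiseI)
  show "frobenius M M \<noteq> 0" if "M \<in> set_B m n" for M
    using that frob U(2) W(2) by (auto simp: B)
  \<comment> \<open>Needed to turn the sum over \<open>set_B m n\<close> into a sum over pairs.
    Equal outer products have a nonzero Frobenius product, which orthogonality excludes for distinct
    pairs.\<close>
  have inj: "inj_on (\<lambda>(u, w). outer_prod u w) (?U \<times> ?W)"
  proof (intro inj_onI, clarify)
    fix u w u' w'
    assume mem: "u \<in> ?U" "w \<in> ?W" "u' \<in> ?U" "w' \<in> ?W" and eq: "outer_prod u w = outer_prod u' w'"
    have "frobenius (outer_prod u w) (outer_prod u' w') \<noteq> 0"
      unfolding eq[symmetric] using frob mem U(2) W(2) by simp
    then show "u = u' \<and> w = w'" using orth mem by blast
  qed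
  fix X i j
  assume X: "X \<in> carrier (zero_sum_space m n)" and i: "i < m" and j: "j < n"
  have KU: "proj_kernel ?U k i = of_bool (k = i) - 1 / m" if "k < m" for k
    using orth_systems(1) that i by (simp add: orth_system_def)
  have KW: "proj_kernel ?W l j = of_bool (l = j) - 1 / n" if "l < n" for l
    using orth_systems(2) that j by (simp add: orth_system_def)
  have rows: "(\<Sum>l<n. X $$ (k, l)) = 0" if "k < m" for k
    using X that by (simp add: carrier_zero_sum_space)
  have cols: "(\<Sum>k<m. X $$ (k, l)) = 0" if "l < n" for l
    using X that by (simp add: carrier_zero_sum_space)
  \<comment> \<open>Zero row sums make the kernel of \<open>?W\<close> act as the identity from the
    right; zero column sums do the same for \<open>?U\<close> from the left.\<close>
  have XW: "(\<Sum>l<n. X $$ (k, l) * proj_kernel ?W l j) = X $$ (k, j)" if "k < m" for k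
    using sum_times_centering[OF rows[OF that] j] by (simp add: KW)
  have UX: "(\<Sum>k<m. proj_kernel ?U k i * X $$ (k, j)) = X $$ (i, j)"
    using sum_times_centering[OF cols[OF j] i] by (simp add: KU mult.commute)
  have summand: "frobenius X (outer_prod u w) / frobenius (outer_prod u w) (outer_prod u w) * outer_prod u w $$ (i, j)
      = (\<Sum>k<m. \<Sum>l<n. (u $ k * u $ i / (u \<bullet> u)) * (X $$ (k, l) * (w $ l * w $ j / (w \<bullet> w))))"
    if uw: "u \<in> ?U" "w \<in> ?W" for u w
  proof -
    have "X \<in> carrier_mat (dim_vec u) (dim_vec w)"
      using X uw by (simp add: carrier_zero_sum_space U W)
    moreover have "outer_prod u w $$ (i, j) = u $ i * w $ j"
      using uw i j by (simp add: outer_prod_def U W)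
    ultimately show ?thesis
      using uw by (simp add: frob frobenius_outer_prod_right U W sum_distrib_left sum_distrib_right sum_divide_distrib mult_ac)
  qed
  \<comment> \<open>The expansion is entry (i, j) of the product of the kernel of \<open>?U\<close>,
    the matrix \<open>X\<close> and the kernel of \<open>?W\<close>. The sums are interchanged until
    first the kernel of \<open>?W\<close> and then that of \<open>?U\<close> appears and is
    absorbed.\<close>
  have "(\<Sum>M\<in>set_B m n. frobenius X M / frobenius M M * M $$ (i, j)) =
      (\<Sum>(u, w)\<in>?U \<times> ?W. \<Sum>k<m. \<Sum>l<n. (u $ k * u $ i / (u \<bullet> u)) * (X $$ (k, l) * (w $ l * w $ j / (w \<bullet> w))))"
    unfolding B sum.reindex[OF inj] by (intro sum.cong refl) (elim SigmaE, simp only: comp_apply prod.case summand)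
  also have "\<dots> = (\<Sum>u\<in>?U. \<Sum>w\<in>?W. \<Sum>k<m. (u $ k * u $ i / (u \<bullet> u)) *
      (\<Sum>l<n. X $$ (k, l) * (w $ l * w $ j / (w \<bullet> w))))"
    unfolding sum.cartesian_product[symmetric] sum_distrib_left ..
  also have "\<dots> = (\<Sum>u\<in>?U. \<Sum>k<m. \<Sum>w\<in>?W. (u $ k * u $ i / (u \<bullet> u)) *
      (\<Sum>l<n. X $$ (k, l) * (w $ l * w $ j / (w \<bullet> w))))"
    by (intro sum.cong refl sum.swap)
  also have "\<dots> = (\<Sum>u\<in>?U. \<Sum>k<m. (u $ k * u $ i / (u \<bullet> u)) *
      (\<Sum>w\<in>?W. \<Sum>l<n. X $$ (k, l) * (w $ l * w $ j / (w \<bullet> w))))"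
    unfolding sum_distrib_left ..
  also have "\<dots> = (\<Sum>u\<in>?U. \<Sum>k<m. (u $ k * u $ i / (u \<bullet> u)) *
      (\<Sum>l<n. X $$ (k, l) * proj_kernel ?W l j))"
    unfolding proj_kernel_def sum_distrib_left[of "X $$ _"] by (subst (2) sum.swap) (rule refl)
  also have "\<dots> = (\<Sum>u\<in>?U. \<Sum>k<m. (u $ k * u $ i / (u \<bullet> u)) * X $$ (k, j))"
    by (simp add: XW)
  also have "\<dots> = (\<Sum>k<m. proj_kernel ?U k i * X $$ (k, j))"
    unfolding proj_kernel_def sum_distrib_right by (rule sum.swap)
  also note UX
  finally show "X $$ (i, j) = (\<Sum>M\<in>set_B m n. frobenius X M / frobenius M M * M $$ (i, j))" ..
qed

end
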